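(* Let $\phi_1,\phi_2$ be complex polynomials of degree at least $2$. For a polynomial $\phi$ of degree at least 2, let $I_\phi$ be the set of indices $i\ge 2$ such that the coefficient of $x^i$ in $\phi$ is non-zero. Then $$\mathfrak{h}_{\phi_1}\cong\mathfrak{h}_{\phi_2}\iff I_{\phi_1}=I_{\phi_2},$$ and moreover $$\mathfrak{g}_{\phi_1}\cong\mathfrak{g}_{\phi_2}\iff I_{\phi_1}=I_{\phi_2},$$ where $\cong$ denotes isomorphism of complex Lie algebras.
   Context: Fix $N\in\mathbb{N}$, a real number $\nu>0$ and real numbers $a_1,\dots,a_{N-1}$. Let $E_{i,j}$ be the $N\times N$ matrix units and $$J=\sum_{k=1}^N kE_{k,k},\qquad A=\sum_{k=1}^{N-1}a_kE_{k+1,k}.$$ Differential operators $\mathcal{E}=\sum_j \partial_x^jF_j(x)$ with matrix valued coefficients act from the right on $N\times N$ matrix valued functions by $P\cdot\mathcal{E}=\sum_j P^{(j)}(x)F_j(x)$; products are defined by $P\cdot(\mathcal{E}_1\mathcal{E}_2)=(P\cdot\mathcal{E}_1)\cdot\mathcal{E}_2$ and $[\mathcal{E}_1,\mathcal{E}_2]=\mathcal{E}_1\mathcal{E}_2-\mathcal{E}_2\mathcal{E}_1$. Scalars denote multiples of the identity matrix, and scalar functions of $x$ act by multiplication. For a polynomial $\phi$ put $$\mathcal{D}=\partial_x x+x(A-1),\qquad \mathcal{D}^\dagger=-\partial_x x-(1+\nu+J)+x\phi'(x)-x,$$ $$\mathfrak{g}_\phi=\operatorname{span}_{\mathbb{C}}\{1,\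 \mathcal{D},\ \mathcal{D}^\dagger,\ x,\ x\phi'(x),\ x^2\phi^{(2)}(x),\ldots\},\qquad \mathfrak{h}_\phi=\operatorname{span}_{\mathbb{C}}\{\mathcal{D},\ x,\ x\phi'(x),\ x^2\phi^{(2)}(x),\ldots\},$$ which are complex Lie algebras under the commutator bracket. *)

theory Defs
  imports "HOL-Analysis.Analysis" "HOL-Library.Function_Algebras"
    "HOL-Computational_Algebra.Polynomial"
begin

section \<open>Matrices\<close>

text \<open>
  \<open>N\<close> is the cardinality of the index type \<open>'n\<close>, a nonempty finite linear order; \<open>pos\<close> is the
  order isomorphism from \<open>'n\<close> onto \<open>{1..N}\<close>. A scalar \<open>c\<close> is identified with the matrix \<open>mat c\<close>.
\<close>

definition pos :: "'n::{finite,linorder} \<Rightarrow> nat" where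
  "pos i = card {j. j \<le> i}"

definition matrix_unit :: "nat \<Rightarrow> nat \<Rightarrow> complex ^ 'n::{finite,linorder} ^ 'n::{finite,linorder}" where
  "matrix_unit i j = (\<chi> r c. if pos r = i \<and> pos c = j then 1 else 0)"

definition J_mat :: "complex ^ 'n::{finite,linorder} ^ 'n::{finite,linorder}" where
  "J_mat = (\<Sum>k = 1..CARD('n). mat (of_nat k) ** matrix_unit k k)"

definition A_mat :: "(nat \<Rightarrow> real) \<Rightarrow> complex ^ 'n::{finite,linorder} ^ 'n::{finite,linorder}" where
  "A_mat a = (\<Sum>k = 1..CARD('n) - 1. mat (of_real (a k)) ** matrix_unit (Suc k) k)"


section \<open>Matrix differential operators\<close>

type_synonym 'n mfun = "real \<Rightarrow> complex ^ 'n ^ 'n"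

type_synonym 'n mop = "'n mfun \<Rightarrow> 'n mfun"

definition mderiv :: "'n::finite mfun \<Rightarrow> 'n mfun" where
  "mderiv P = (\<lambda>x. vector_derivative P (at x))"

definition smooth :: "'n::finite mfun \<Rightarrow> bool" where
  "smooth P \<longleftrightarrow> (\<forall>k x. (mderiv ^^ k) P differentiable (at x))"

text \<open>
  An operator is identified with its right action on smooth matrix valued functions. As functions
  are total in HOL, operators are set to \<open>0\<close> outside the smooth functions, so that two of them are
  equal iff they agree on all smooth functions. The list \<open>[F\<^sub>0, \<dots>, F\<^sub>m]\<close> of coefficients stands for
  \<open>\<Sum>j. \<partial>\<^sub>x\<^sup>j F\<^sub>j(x)\<close>. Coefficients below are polynomial, hence preserve smoothness.
\<close>

definition diff_op :: "'n::finite mfun list \<Rightarrow> 'n mop" where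
  "diff_op Fs = (\<lambda>P. if smooth P
     then (\<lambda>x. \<Sum>j<length Fs. (mderiv ^^ j) P x ** (Fs ! j) x) else 0)"

definition mult_op :: "(real \<Rightarrow> complex) \<Rightarrow> 'n::finite mop" where
  "mult_op f = diff_op [\<lambda>x. mat (f x)]"

definition op_scale :: "complex \<Rightarrow> 'n::finite mop \<Rightarrow> 'n mop" where
  "op_scale c E = (\<lambda>P x. mat c ** E P x)"

text \<open>Operators act from the right: in a product, the left factor is applied first.\<close>

definition op_mult :: "'n::finite mop \<Rightarrow> 'n mop \<Rightarrow> 'n mop" where
  "op_mult E1 E2 = (\<lambda>P. E2 (E1 P))"

definition op_bracket :: "'n::finite mop \<Rightarrow> 'n mop \<Rightarrow> 'n mop" where
  "op_bracket E1 E2 = op_mult E1 E2 - op_mult E2 E1"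

lemma mat_mult_nth: "(mat c ** (M :: complex ^ 'n::finite ^ 'n)) $ i $ j = c * M $ i $ j"
  by (simp add: matrix_matrix_mult_def mat_def if_distrib[where f = "\<lambda>x. x * _"] cong: if_cong)

interpretation mop: vector_space "op_scale :: complex \<Rightarrow> 'n::finite mop \<Rightarrow> 'n mop"
  by unfold_locales
    (auto simp: op_scale_def fun_eq_iff vec_eq_iff mat_mult_nth algebra_simps)


section \<open>The Lie algebras\<close>

definition D_op :: "(nat \<Rightarrow> real) \<Rightarrow> 'n::{finite,linorder} mop" where
  "D_op a = diff_op
     [\<lambda>x. mat (of_real x) ** (A_mat a - mat 1),
      \<lambda>x. mat (of_real x)]"

definition D_dag_op :: "real \<Rightarrow> complex poly \<Rightarrow> 'n::{finite,linorder} mop" where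
  "D_dag_op \<nu> \<phi> = diff_op
     [\<lambda>x. - (mat (1 + of_real \<nu>) + J_mat)
            + mat (of_real x * poly (pderiv \<phi>) (of_real x)) - mat (of_real x),
      \<lambda>x. - mat (of_real x)]"

definition pow_deriv_op :: "complex poly \<Rightarrow> nat \<Rightarrow> 'n::finite mop" where
  "pow_deriv_op \<phi> k = mult_op (\<lambda>x. of_real x ^ k * poly ((pderiv ^^ k) \<phi>) (of_real x))"

definition g_alg :: "real \<Rightarrow> (nat \<Rightarrow> real) \<Rightarrow> complex poly \<Rightarrow> 'n::{finite,linorder} mop set" where
  "g_alg \<nu> a \<phi> = mop.span
     ({mult_op (\<lambda>_. 1), D_op a, D_dag_op \<nu> \<phi>, mult_op of_real} \<union> {pow_deriv_op \<phi> k | k. k \<ge> 1})"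

definition h_alg :: "(nat \<Rightarrow> real) \<Rightarrow> complex poly \<Rightarrow> 'n::{finite,linorder} mop set" where
  "h_alg a \<phi> = mop.span
     ({D_op a, mult_op of_real} \<union> {pow_deriv_op \<phi> k | k. k \<ge> 1})"

text \<open>
  Isomorphism of complex Lie algebras, for complex subspaces of operators closed under the commutator.
\<close>

definition lie_isomorphic :: "'n::finite mop set \<Rightarrow> 'm::finite mop set \<Rightarrow> bool" where
  "lie_isomorphic L M \<longleftrightarrow> (\<exists>f. bij_betw f L M
     \<and> (\<forall>X\<in>L. \<forall>Y\<in>L. f (X + Y) = f X + f Y)
     \<and> (\<forall>c. \<forall>X\<in>L. f (op_scale c X) = op_scale c (f X))
     \<and> (\<forall>X\<in>L. \<forall>Y\<in>L. f (op_bracket X Y) = op_bracket (f X) (f Y)))"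

definition index_set :: "complex poly \<Rightarrow> nat set" where
  "index_set \<phi> = {i. i \<ge> 2 \<and> coeff \<phi> i \<noteq> 0}"

end

theory Submission imports Defs begin

text \<open>
  Write \<open>\<theta> = x d/dx\<close>, \<open>S = {1} \<union> I\<^sub>\<phi>\<close>, and let \<open>V\<close> be the span of \<open>x\<^sup>i\<close> with \<open>i \<in> S\<close>.

  The functions \<open>x, x \<phi>', x\<^sup>2 \<phi>'', \<dots>\<close> span \<open>V\<close>: their span is invariant under \<open>\<theta>\<close>, and a
  \<open>\<theta>\<close>-invariant space of polynomials contains every monomial that occurs in one of its elements
  (lemma \<open>span_weighted_derivs\<close>). Hence \<open>\<hh>\<^sub>\<phi>\<close> is spanned by \<open>\<D>\<close> and \<open>V\<close>. Moreover
  \<open>\<D> + \<D>\<^sup>\<dagger>\<close> differs from \<open>z = x A - J\<close> by a polynomial in \<open>V\<close> and a constant, so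
  \<open>\<gg>\<^sub>\<phi>\<close> is spanned by \<open>1\<close>, \<open>z\<close>, \<open>\<D>\<close> and \<open>V\<close>. None of \<open>1\<close>, \<open>z\<close>, \<open>\<D>\<close> involves \<open>\<phi>\<close>, so
  equal index sets give not merely isomorphic but equal algebras (lemmas \<open>h_alg_eq\<close> and \<open>g_alg_eq\<close>).

  Conversely, \<open>1\<close> and \<open>z\<close> are central, because \<open>A J - J A = - A\<close>, while \<open>V\<close> is abelian and
  \<open>[\<D>, p] = - \<theta> p\<close> (lemma \<open>lie_elem_bracket\<close>). The spectrum of \<open>\<D>\<close> on the derived algebra
  \<open>V\<close> is therefore \<open>- S\<close>. An isomorphism maps \<open>\<D>\<close> to an element that acts on the derived algebra
  of the target as a multiple of \<open>\<D>\<close>, so it rescales the exponents. Since \<open>1\<close> is an exponent on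
  both sides, the rescaling is, in either direction, multiplication by a positive integer, and as the
  sets are finite this integer is \<open>1\<close>
  (lemmas \<open>isomorphism_rescales_exponents\<close> and \<open>eq_of_mutual_rescaling\<close>).
\<close>

section \<open>Matrix arithmetic\<close>

type_synonym 'n cmat = "complex ^ 'n ^ 'n"

lemma mat_nth: "mat c $ i $ j = (if i = j then c else 0)"
  by (simp add: mat_def)

lemma mult_mat_nth: "((M :: complex ^ 'n::finite ^ 'n) ** mat c) $ i $ j = c * M $ i $ j"
  by (simp add: matrix_matrix_mult_def mat_def if_distrib cong: if_cong)

lemma matrix_mult_left_mat:
  fixes M K :: "complex ^ 'n::finite ^ 'n"
  shows "(mat c ** M) ** K = mat c ** (M ** K)" and "M ** (mat c ** K) = mat c ** (M ** K)"
proof -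
  have "M ** mat c = mat c ** M"
    by (simp add: vec_eq_iff mult_mat_nth mat_mult_nth)
  thus "M ** (mat c ** K) = mat c ** (M ** K)"
    by (metis matrix_mul_assoc)
qed (simp add: matrix_mul_assoc)

lemma matrix_add_rdistrib:
  fixes A B C :: "complex ^ 'n::finite ^ 'n"
  shows "(A + B) ** C = A ** C + B ** C"
  by (simp add: matrix_matrix_mult_def vec_eq_iff sum.distrib distrib_right)

section \<open>Smooth matrix functions\<close>

lemma bounded_bilinear_matrix_mult:
  "bounded_bilinear (\<lambda>(M :: complex ^ 'n::finite ^ 'n) (K :: complex ^ 'n ^ 'n). M ** K)"
  unfolding bilinear_conv_bounded_bilinear [symmetric] bilinear_def
  by (auto intro!: linearI simp: matrix_add_ldistrib matrix_add_rdistrib scalar_matrix_assoc matrix_scalar_ac)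

lemma bounded_linear_mat: "bounded_linear (mat :: complex \<Rightarrow> complex ^ 'n::finite ^ 'n)"
  unfolding linear_conv_bounded_linear [symmetric]
  by (auto intro!: linearI simp: mat_def vec_eq_iff)

lemma has_vector_derivative_matrix_mult:
  fixes P Q :: "'n::finite mfun"
  assumes "(P has_vector_derivative P') (at x)" "(Q has_vector_derivative Q') (at x)"
  shows "((\<lambda>x. P x ** Q x) has_vector_derivative P' ** Q x + P x ** Q') (at x)"
  using bounded_bilinear.FDERIV [OF bounded_bilinear_matrix_mult assms [unfolded has_vector_derivative_def]]
  by (simp add: has_vector_derivative_def scalar_matrix_assoc matrix_scalar_ac scaleR_add_right add.commute)

lemma mderiv_has_vector_derivative:
  assumes "smooth P"
  shows "(P has_vector_derivative mderiv P x) (at x)"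
proof -
  have "P differentiable (at x)"
    using assms funpow_0 unfolding smooth_def by metis
  thus ?thesis by (simp add: mderiv_def vector_derivative_works)
qed

lemma mderiv_eqI: "(\<And>x. (P has_vector_derivative P' x) (at x)) \<Longrightarrow> mderiv P = P'"
  by (auto simp: mderiv_def vector_derivative_at)

lemma smooth_mderiv: "smooth P \<Longrightarrow> smooth (mderiv P)"
  unfolding smooth_def by (metis funpow_Suc_right o_apply)

text \<open>
  Smoothness is a greatest fixed point: any family of differentiable functions that is closed under
  differentiation consists of smooth functions. This replaces explicit formulas for higher
  derivatives of products and sums.
\<close>

lemma smooth_coinduct:
  assumes "P \<in> X"
    and step: "\<And>P. P \<in> X \<Longrightarrow> mderiv P \<in> X \<and> (\<forall>x. P differentiable (at x))"
  shows "smooth P"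
proof -
  have "(mderiv ^^ k) P \<in> X" for k
    using assms by (induction k) auto
  thus ?thesis using step by (auto simp: smooth_def)
qed

text \<open>
  The Leibniz rule turns a product into a sum of two products, so a family containing the
  products has to contain their sums as well before it can be closed under differentiation.
\<close>

inductive_set product_sums :: "'n::finite mfun set" where
  product: "smooth P \<Longrightarrow> smooth Q \<Longrightarrow> (\<lambda>x. P x ** Q x) \<in> product_sums"
| sum: "P \<in> product_sums \<Longrightarrow> Q \<in> product_sums \<Longrightarrow> (\<lambda>x. P x + Q x) \<in> product_sums"

lemma product_sums_smooth:
  assumes "P \<in> product_sums"
  shows "smooth P"
  using assms
proof (rule smooth_coinduct)
  fix P :: "'a mfun" assume "P \<in> product_sums"
  thus "mderiv P \<in> product_sums \<and> (\<forall>x. P differentiable (at x))"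
  proof induction
    case (product P Q)
    have D: "((\<lambda>x. P x ** Q x) has_vector_derivative mderiv P x ** Q x + P x ** mderiv Q x) (at x)" for x
      by (intro has_vector_derivative_matrix_mult mderiv_has_vector_derivative product)
    have "(\<lambda>x. mderiv P x ** Q x + P x ** mderiv Q x) \<in> product_sums"
      by (intro product_sums.intros smooth_mderiv product)
    thus ?case using mderiv_eqI [OF D] differentiableI_vector [OF D] by simp
  next
    case (sum P Q)
    hence "(P has_vector_derivative mderiv P x) (at x)" "(Q has_vector_derivative mderiv Q x) (at x)" for x
      by (auto simp: mderiv_def vector_derivative_works)
    hence D: "((\<lambda>x. P x + Q x) has_vector_derivative mderiv P x + mderiv Q x) (at x)" for x
      by (intro has_vector_derivative_add)
    show ?case using mderiv_eqI [OF D] differentiableI_vector [OF D] sum by (simp add: product_sums.sum)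
  qed
qed

lemma smooth_matrix_mult: "smooth P \<Longrightarrow> smooth Q \<Longrightarrow> smooth (\<lambda>x. P x ** Q x)"
  by (rule product_sums_smooth) (rule product_sums.product)

lemma smooth_poly_mat: "smooth (\<lambda>x. mat (poly p (of_real x)) ** M)"
  and mderiv_poly_mat:
    "mderiv (\<lambda>x. mat (poly p (of_real x)) ** M) = (\<lambda>x. mat (poly (pderiv p) (of_real x)) ** M)"
  for M :: "complex ^ 'n::finite ^ 'n"
proof -
  let ?F = "\<lambda>p x. mat (poly p (of_real x)) ** M"
  have D: "(?F p has_vector_derivative ?F (pderiv p) x) (at x)" for p and x :: real
  proof -
    have "((\<lambda>x. poly p (of_real x)) has_vector_derivative poly (pderiv p) (of_real x)) (at x)"
      by (intro has_vector_derivative_real_field poly_DERIV)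
    moreover have "bounded_linear (\<lambda>c. mat c ** M)"
      using bounded_linear_compose [OF bounded_bilinear.bounded_linear_left
          [OF bounded_bilinear_matrix_mult] bounded_linear_mat] .
    ultimately show ?thesis
      using bounded_linear.has_vector_derivative by blast
  qed
  show D': "mderiv (?F p) = ?F (pderiv p)" for p
    using mderiv_eqI [OF D] .
  have "?F p \<in> range ?F" by blast
  thus "smooth (?F p)"
    by (rule smooth_coinduct) (use D' differentiableI_vector [OF D] in auto)
qed

text \<open>
  The pointwise products with the identity matrix exhibit the sum as an element of
  \<^const>\<open>product_sums\<close>.
\<close>

lemma smooth_add:
  assumes "smooth P" "smooth Q"
  shows "smooth (\<lambda>x. P x + Q x)"
proof -
  have *: "smooth (\<lambda>x. mat 1)"
    using smooth_poly_mat [of 1 "mat 1"] by simp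
  have "(\<lambda>x. P x ** mat 1 + Q x ** mat 1) \<in> product_sums"
    by (intro product_sums.intros assms *)
  thus ?thesis using product_sums_smooth by force
qed

lemma mderiv_add:
  assumes "smooth P" "smooth Q"
  shows "mderiv (\<lambda>x. P x + Q x) = (\<lambda>x. mderiv P x + mderiv Q x)"
  using assms by (intro mderiv_eqI has_vector_derivative_add mderiv_has_vector_derivative)

section \<open>First-order operators with leading coefficient proportional to the identity\<close>

text \<open>
  The operator \<open>\<alpha> \<partial>\<^sub>x x\<close> plus a matrix coefficient of order zero. All the generators have this
  shape. Since \<open>\<partial>\<^sub>x x\<close> has scalar leading coefficient, the second-order
  terms cancel in commutators, and brackets of such operators have order zero.
\<close>

definition euler_op :: "complex \<Rightarrow> 'n::finite mfun \<Rightarrow> 'n mop" where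
  "euler_op \<alpha> F = diff_op [F, \<lambda>x. mat (\<alpha> * of_real x)]"

lemma euler_op_apply:
  "euler_op \<alpha> F P = (if smooth P then \<lambda>x. P x ** F x + mat (\<alpha> * of_real x) ** mderiv P x else 0)"
  by (auto simp: euler_op_def diff_op_def fun_eq_iff vec_eq_iff mult_mat_nth mat_mult_nth)

lemma mult_op_eq_euler_op: "mult_op f = euler_op 0 (\<lambda>x. mat (f x))"
  by (rule ext) (simp add: mult_op_def diff_op_def euler_op_apply)

lemma euler_op_add: "euler_op \<alpha> F + euler_op \<beta> G = euler_op (\<alpha> + \<beta>) (\<lambda>x. F x + G x)"
  by (auto simp: euler_op_apply fun_eq_iff vec_eq_iff mat_mult_nth matrix_add_ldistrib algebra_simps)

lemma euler_op_scale: "op_scale c (euler_op \<alpha> F) = euler_op (c * \<alpha>) (\<lambda>x. mat c ** F x)"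
  by (auto simp: euler_op_apply op_scale_def fun_eq_iff vec_eq_iff mat_mult_nth matrix_mult_left_mat algebra_simps)

text \<open>
  Applying the operator to the constant \<open>1\<close> recovers the coefficient of order zero, and applying it
  to \<open>x\<close> then recovers the leading coefficient.
\<close>

lemma euler_op_inject:
  fixes F G :: "'n::finite mfun"
  shows "euler_op \<alpha> F = euler_op \<beta> G \<longleftrightarrow> \<alpha> = \<beta> \<and> F = G"
proof
  assume eq: "euler_op \<alpha> F = euler_op \<beta> G"
  have poly: "smooth (\<lambda>x. mat (poly p (of_real x)) :: complex ^ 'n ^ 'n)"
    "mderiv (\<lambda>x. mat (poly p (of_real x)) :: complex ^ 'n ^ 'n)
      = (\<lambda>x. mat (poly (pderiv p) (of_real x)))" for p
    using smooth_poly_mat [of p "mat 1"] mderiv_poly_mat [of p "mat 1"] by simp_all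
  have F: "F x = G x" for x
    using fun_cong [OF fun_cong [OF eq, of "\<lambda>x. mat (poly 1 (of_real x))"], of x] poly [of 1]
    by (simp add: euler_op_apply pderiv_1)
  moreover have "\<alpha> = \<beta>"
    using fun_cong [OF fun_cong [OF eq, of "\<lambda>x. mat (poly [:0,1:] (of_real x))"], of 1] poly [of "[:0,1:]"] F
    by (simp add: euler_op_apply pderiv_pCons vec_eq_iff mat_mult_nth mat_nth) (metis (full_types))
  ultimately show "\<alpha> = \<beta> \<and> F = G" by auto
qed auto

lemma smooth_euler_op:
  assumes "smooth P" "smooth F"
  shows "smooth (euler_op \<alpha> F P)"
    and "mderiv (euler_op \<alpha> F P) = (\<lambda>x. mderiv P x ** F x + P x ** mderiv F x + mat \<alpha> ** mderiv P x
      + mat (\<alpha> * of_real x) ** mderiv (mderiv P) x)"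
proof -
  let ?X = "\<lambda>x. mat (\<alpha> * of_real x) :: complex ^ 'a ^ 'a"
  have X: "smooth ?X" "mderiv ?X = (\<lambda>x. mat \<alpha>)"
    using smooth_poly_mat [of "[:0, \<alpha>:]" "mat 1"] mderiv_poly_mat [of "[:0, \<alpha>:]" "mat 1"]
    by (simp_all add: pderiv_pCons mult.commute)
  show "smooth (euler_op \<alpha> F P)"
    unfolding euler_op_apply using assms X
    by (auto intro!: smooth_add smooth_matrix_mult smooth_mderiv)
  have "((\<lambda>x. P x ** F x + ?X x ** mderiv P x) has_vector_derivative
     (mderiv P x ** F x + P x ** mderiv F x) + (mat \<alpha> ** mderiv P x + ?X x ** mderiv (mderiv P) x)) (at x)" for x
    using X mderiv_has_vector_derivative [OF X(1), of x] assms
    by (intro has_vector_derivative_add has_vector_derivative_matrix_mult)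
       (auto intro!: mderiv_has_vector_derivative smooth_mderiv)
  from mderiv_eqI [OF this]
  show "mderiv (euler_op \<alpha> F P) = (\<lambda>x. mderiv P x ** F x + P x ** mderiv F x + mat \<alpha> ** mderiv P x
      + mat (\<alpha> * of_real x) ** mderiv (mderiv P) x)"
    using assms by (simp add: euler_op_apply add.assoc)
qed

text \<open>
  In the composition the second derivatives of \<open>P\<close> occur with the coefficient \<open>\<alpha> \<beta> x\<^sup>2\<close> in either
  order, and the terms \<open>P' F\<close> and \<open>P' G\<close> occur symmetrically as well. Only the matrix commutator and
  the derivatives of the coefficients survive.
\<close>

lemma op_bracket_euler_op:
  fixes F G :: "'n::finite mfun"
  assumes "smooth F" "smooth G"
  shows "op_bracket (euler_op \<alpha> F) (euler_op \<beta> G) = euler_op 0 (\<lambda>x. F x ** G x - G x ** F x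
           + mat (\<beta> * of_real x) ** mderiv F x - mat (\<alpha> * of_real x) ** mderiv G x)" (is "_ = euler_op 0 ?H")
proof (intro ext)
  fix P :: "'n mfun" and x
  show "op_bracket (euler_op \<alpha> F) (euler_op \<beta> G) P x = euler_op 0 ?H P x"
  proof (cases "smooth P")
    case True
    have "op_bracket (euler_op \<alpha> F) (euler_op \<beta> G) P x
      = euler_op \<beta> G (euler_op \<alpha> F P) x - euler_op \<alpha> F (euler_op \<beta> G P) x"
      by (simp add: op_bracket_def op_mult_def)
    also have "\<dots> = euler_op \<alpha> F P x ** G x + mat (\<beta> * of_real x) ** mderiv (euler_op \<alpha> F P) x
       - (euler_op \<beta> G P x ** F x + mat (\<alpha> * of_real x) ** mderiv (euler_op \<beta> G P) x)"
      using smooth_euler_op(1) [OF True] assms by (simp add: euler_op_apply [where P = "euler_op _ _ _"])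
    also have "\<dots> = P x ** ?H x"
      unfolding smooth_euler_op(2) [OF True assms(1)] smooth_euler_op(2) [OF True assms(2)]
      using True
      by (simp add: euler_op_apply vec_eq_iff mat_mult_nth matrix_add_ldistrib matrix_add_rdistrib
          bounded_bilinear.diff_left [OF bounded_bilinear_matrix_mult]
          bounded_bilinear.diff_right [OF bounded_bilinear_matrix_mult]
          matrix_mult_left_mat(2) [of "P x"] algebra_simps flip: matrix_mul_assoc)
    finally show ?thesis using True by (simp add: euler_op_apply)
  next
    case False
    have "euler_op \<gamma> K 0 = 0" for \<gamma> and K :: "'n mfun"
      using mderiv_poly_mat [of 0 "0 :: complex ^ 'n ^ 'n"]
      by (simp add: euler_op_apply zero_fun_def fun_eq_iff vec_eq_iff mat_mult_nth)
    with False show ?thesis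
      by (simp add: op_bracket_def op_mult_def euler_op_apply [of _ _ P])
  qed
qed

section \<open>The commutator of A and J\<close>

lemma pos_strict_mono: "i < j \<Longrightarrow> pos i < pos j"
  unfolding pos_def by (rule psubset_card_mono) (auto simp: psubset_eq set_eq_iff intro!: exI [of _ j])

lemma pos_inject: "pos i = pos j \<longleftrightarrow> i = j"
  using pos_strict_mono by (metis linorder_less_linear nat_less_le)

lemma pos_bounds: "1 \<le> pos (i :: 'n::{finite,linorder})" "pos i \<le> CARD('n)"
proof -
  have "{j. j \<le> i} \<noteq> {}" by auto
  thus "1 \<le> pos i" unfolding pos_def by (simp add: Suc_le_eq card_gt_0_iff)
  show "pos i \<le> CARD('n)" unfolding pos_def by (rule card_mono) auto
qed

lemma J_mat_nth: "(J_mat :: 'n::{finite,linorder} cmat) $ r $ c = (if r = c then of_nat (pos r) else 0)"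
proof -
  have "(J_mat :: 'n cmat) $ r $ c
     = (\<Sum>k = 1..CARD('n). if k = pos r then if pos c = pos r then of_nat (pos r) else 0 else 0)"
    unfolding J_mat_def sum_component
    by (intro sum.cong refl) (auto simp: matrix_unit_def mat_mult_nth)
  thus ?thesis using pos_bounds [of r] by (auto simp: sum.delta pos_inject)
qed

lemma A_mat_nth:
  "(A_mat a :: 'n::{finite,linorder} cmat) $ r $ c = (if pos r = Suc (pos c) then of_real (a (pos c)) else 0)"
proof -
  have "(A_mat a :: 'n cmat) $ r $ c
     = (\<Sum>k = 1..CARD('n) - 1. if k = pos c then if pos r = Suc (pos c) then of_real (a (pos c)) else 0 else 0)"
    unfolding A_mat_def sum_component
    by (intro sum.cong refl) (auto simp: matrix_unit_def mat_mult_nth)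
  thus ?thesis using pos_bounds [of c] pos_bounds [of r] by (auto simp: sum.delta)
qed

text \<open>
  \<open>A\<close> maps weight \<open>k\<close> to weight \<open>k + 1\<close> in the grading by the eigenvalues of \<open>J\<close>, so
  it is itself an eigenvector of the commutator with \<open>J\<close>.
\<close>

lemma commutator_A_J: "A_mat a ** J_mat - J_mat ** A_mat a = - (A_mat a :: 'n::{finite,linorder} cmat)"
proof -
  have AJ: "(A_mat a ** J_mat) $ r $ c = of_nat (pos c) * A_mat a $ r $ c" for r c :: 'n
  proof -
    have "(A_mat a ** J_mat) $ r $ c = (\<Sum>k\<in>UNIV. if k = c then of_nat (pos c) * A_mat a $ r $ c else 0)"
      unfolding matrix_matrix_mult_def vec_lambda_beta
      by (intro sum.cong refl) (auto simp: J_mat_nth)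
    thus ?thesis by simp
  qed
  have JA: "(J_mat ** A_mat a) $ r $ c = of_nat (pos r) * A_mat a $ r $ c" for r c :: 'n
  proof -
    have "(J_mat ** A_mat a) $ r $ c = (\<Sum>k\<in>UNIV. if k = r then of_nat (pos r) * A_mat a $ r $ c else 0)"
      unfolding matrix_matrix_mult_def vec_lambda_beta
      by (intro sum.cong refl) (auto simp: J_mat_nth)
    thus ?thesis by simp
  qed
  show ?thesis
    by (auto simp: vec_eq_iff AJ JA A_mat_nth algebra_simps)
qed

section \<open>A uniform description of the Lie algebra elements\<close>

definition AJ_fun ::
  "(nat \<Rightarrow> real) \<Rightarrow> complex poly \<Rightarrow> complex poly \<Rightarrow> complex poly \<Rightarrow> 'n::{finite,linorder} mfun" where
  "AJ_fun a f g p = (\<lambda>x. mat (poly f (of_real x)) ** A_mat a + mat (poly g (of_real x)) ** J_mat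
     + mat (poly p (of_real x)))"

lemma smooth_AJ_fun: "smooth (AJ_fun a f g p)"
  and mderiv_AJ_fun: "mderiv (AJ_fun a f g p) = AJ_fun a (pderiv f) (pderiv g) (pderiv p)"
proof -
  have p: "smooth (\<lambda>x. mat (poly p (of_real x)))"
    "mderiv (\<lambda>x. mat (poly p (of_real x))) = (\<lambda>x. mat (poly (pderiv p) (of_real x)))"
    using smooth_poly_mat [of p "mat 1"] mderiv_poly_mat [of p "mat 1"] by simp_all
  show "smooth (AJ_fun a f g p)" unfolding AJ_fun_def
    by (intro smooth_add smooth_poly_mat p)
  show "mderiv (AJ_fun a f g p) = AJ_fun a (pderiv f) (pderiv g) (pderiv p)"
    by (simp add: AJ_fun_def mderiv_add smooth_add smooth_poly_mat mderiv_poly_mat p)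
qed

text \<open>
  The scalar parts commute with everything, so only the commutator of \<open>A\<close> and \<open>J\<close> contributes.
\<close>

lemma commutator_AJ_fun:
  fixes x :: real
  shows "(AJ_fun a f g p x :: 'n::{finite,linorder} cmat) ** AJ_fun a f' g' p' x - AJ_fun a f' g' p' x ** AJ_fun a f g p x
     = AJ_fun a (f' * g - f * g') 0 0 x"
proof -
  have nth: "(A_mat a ** J_mat) $ i $ j = (J_mat ** A_mat a) $ i $ j - A_mat a $ i $ j" for i j :: 'n
    using arg_cong [OF commutator_A_J [of a], of "\<lambda>M. M $ i $ j"] by (simp add: algebra_simps)
  show ?thesis
    by (simp add: AJ_fun_def vec_eq_iff mat_mult_nth mult_mat_nth mat_nth matrix_add_ldistrib matrix_add_rdistrib
        matrix_mult_left_mat(2) [of "A_mat a"] matrix_mult_left_mat(2) [of J_mat] nth flip: matrix_mul_assoc) (simp add: algebra_simps)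
qed

text \<open>
  The operator \<open>\<alpha> (\<D> + x) + \<beta> (x A - J) + p(x)\<close>. The element \<open>x A - J\<close> is chosen because it commutes with
  \<open>\<D>\<close> and with all scalar functions, and \<open>\<D>\<^sup>\<dagger>\<close> is this element minus \<open>\<D>\<close> up to a
  scalar polynomial. For \<open>N = 1\<close> the matrix \<open>x A - J\<close> is itself a scalar, so that \<open>\<beta>\<close> and \<open>p\<close> are not
  determined by the operator; arguments below therefore compare only elements with \<open>\<alpha> = \<beta> = 0\<close>.
\<close>

definition lie_elem ::
  "(nat \<Rightarrow> real) \<Rightarrow> complex \<Rightarrow> complex \<Rightarrow> complex poly \<Rightarrow> 'n::{finite,linorder} mop" where
  "lie_elem a \<alpha> \<beta> p = euler_op \<alpha> (AJ_fun a [:0, \<alpha> + \<beta>:] [:-\<beta>:] p)"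

text \<open>
  The Euler derivation \<open>x d/dx\<close>, which is diagonal on monomials.
\<close>

definition theta :: "complex poly \<Rightarrow> complex poly" where
  "theta p = pCons 0 (pderiv p)"

lemma coeff_theta: "coeff (theta p) n = of_nat n * coeff p n"
  by (cases n) (simp_all add: theta_def coeff_pderiv)

lemma lie_elem_add:
  "lie_elem a \<alpha> \<beta> p + lie_elem a \<alpha>' \<beta>' q = lie_elem a (\<alpha> + \<alpha>') (\<beta> + \<beta>') (p + q)"
  unfolding lie_elem_def euler_op_add
  by (rule arg_cong [where f = "euler_op _"])
     (simp add: AJ_fun_def fun_eq_iff vec_eq_iff mat_mult_nth mat_nth matrix_add_ldistrib algebra_simps)

lemma lie_elem_scale: "op_scale c (lie_elem a \<alpha> \<beta> p) = lie_elem a (c * \<alpha>) (c * \<beta>) (smult c p)"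
  unfolding lie_elem_def euler_op_scale
  by (rule arg_cong [where f = "euler_op _"])
     (simp add: AJ_fun_def fun_eq_iff vec_eq_iff mat_mult_nth mat_nth matrix_add_ldistrib algebra_simps)

text \<open>
  The terms with \<open>A\<close> coming from the matrix commutator cancel against those coming from the
  derivative of \<open>(\<alpha> + \<beta>) x A\<close>. Thus \<open>x A - J\<close> is central, and the bracket is governed by the Euler
  derivation alone.
\<close>

lemma lie_elem_bracket:
  "op_bracket (lie_elem a \<alpha> \<beta> p) (lie_elem a \<alpha>' \<beta>' q)
     = lie_elem a 0 0 (smult \<alpha>' (theta p) - smult \<alpha> (theta q))"
  unfolding lie_elem_def op_bracket_euler_op [OF smooth_AJ_fun smooth_AJ_fun]
    commutator_AJ_fun mderiv_AJ_fun
  by (rule arg_cong [where f = "euler_op _"])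
     (simp add: AJ_fun_def fun_eq_iff vec_eq_iff mat_mult_nth mat_nth matrix_add_ldistrib algebra_simps theta_def pderiv_pCons)

lemma lie_elem_scalar_inject:
  "(lie_elem a 0 0 p :: 'n::{finite,linorder} mop) = lie_elem a 0 0 q \<longleftrightarrow> p = q"
proof
  assume "(lie_elem a 0 0 p :: 'n mop) = lie_elem a 0 0 q"
  hence "AJ_fun a 0 0 p = (AJ_fun a 0 0 q :: 'n mfun)"
    by (simp add: lie_elem_def euler_op_inject)
  from fun_cong [OF this] have "(mat (poly p (of_real x)) :: 'n cmat) = mat (poly q (of_real x))" for x :: real
    by (simp add: AJ_fun_def)
  hence eq: "poly p (of_real x) = poly q (of_real x)" for x :: real
    by (simp add: vec_eq_iff mat_nth) (metis (full_types))
  show "p = q"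
  proof (rule ccontr)
    assume "p \<noteq> q"
    hence "finite {z. poly (p - q) z = 0}" by (intro poly_roots_finite) simp
    moreover have "range of_real \<subseteq> {z. poly (p - q) z = 0}" using eq by auto
    ultimately have "finite (range (of_real :: real \<Rightarrow> complex))" by (rule finite_subset [rotated])
    thus False by (simp add: finite_image_iff inj_of_real infinite_UNIV_char_0)
  qed
qed auto

section \<open>Polynomials with prescribed exponents\<close>

definition polys_on :: "nat set \<Rightarrow> complex poly set" where
  "polys_on S = {p. \<forall>i. coeff p i \<noteq> 0 \<longrightarrow> i \<in> S}"

lemma sum_of_monomials: "(p :: complex poly) = (\<Sum>i\<le>degree p. smult (coeff p i) (monom 1 i))"
  using poly_as_sum_of_monoms [of p] by (simp add: smult_monom)

interpretation poly_vs: vector_space "smult :: complex \<Rightarrow> complex poly \<Rightarrow> complex poly"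
  by unfold_locales (simp_all add: smult_add_right smult_add_left)

text \<open>
  Distinct monomials are eigenvectors of \<^const>\<open>theta\<close> with distinct eigenvalues, hence an invariant
  subspace contains every spectral component of each of its elements. The induction removes the
  leading monomial by applying \<open>\<theta> - d\<close>, where \<open>d\<close> is the degree; this preserves all the other
  exponents that occur.
\<close>

lemma monomials_in_theta_invariant_subspace:
  assumes W: "poly_vs.subspace W" and theta: "\<And>p. p \<in> W \<Longrightarrow> theta p \<in> W"
  assumes "p \<in> W" "coeff p i \<noteq> 0"
  shows "monom 1 i \<in> W"
  using assms(3,4)
proof (induction "degree p" arbitrary: p i rule: less_induct)
  case less
  \<comment> \<open>\<open>\<theta> - d\<close> multiplies the coefficient of \<open>x\<^sup>j\<close> by \<open>j - d\<close>.\<close>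
  let ?d = "degree p" and ?q = "theta p - smult (of_nat (degree p)) p"
  have q: "?q \<in> W"
    using less.prems(1) W theta by (auto intro!: poly_vs.subspace_diff poly_vs.subspace_scale)
  have cq: "coeff ?q j = (of_nat j - of_nat ?d) * coeff p j" for j
    by (simp add: coeff_theta algebra_simps)
  have low: "monom 1 j \<in> W" if "j < ?d" "coeff p j \<noteq> 0" for j
  proof (rule less.hyps [OF _ q])
    have nz: "coeff ?q j \<noteq> 0" using that unfolding cq by simp
    have "coeff ?q k = 0" if "k \<ge> ?d" for k
      unfolding cq using that by (cases "k = ?d") (auto simp: coeff_eq_0)
    thus "degree ?q < ?d" using that by (intro degree_lessI) auto
    show "coeff ?q j \<noteq> 0" by fact
  qed
  show ?case
  proof (cases "i = ?d")
    case False
    thus ?thesis using low less.prems le_degree by (metis le_neq_implies_less)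
  next
    case True
    have "p = (\<Sum>j<?d. smult (coeff p j) (monom 1 j)) + smult (coeff p ?d) (monom 1 ?d)"
      using sum_of_monomials [of p] by (simp flip: lessThan_Suc_atMost)
    hence "smult (coeff p ?d) (monom 1 ?d) = p - (\<Sum>j<?d. smult (coeff p j) (monom 1 j))"
      by (metis add_diff_cancel_left')
    moreover have "(\<Sum>j<?d. smult (coeff p j) (monom 1 j)) \<in> W"
    proof (rule poly_vs.subspace_sum [OF W])
      fix j assume "j \<in> {..<?d}"
      thus "smult (coeff p j) (monom 1 j) \<in> W"
        using low [of j] W by (cases "coeff p j = 0") (auto intro: poly_vs.subspace_scale poly_vs.subspace_0)
    qed
    ultimately have "smult (coeff p ?d) (monom 1 ?d) \<in> W"
      using less.prems W by (simp add: poly_vs.subspace_diff)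
    hence "smult (inverse (coeff p ?d)) (smult (coeff p ?d) (monom 1 ?d)) \<in> W"
      using W by (rule poly_vs.subspace_scale [rotated])
    thus ?thesis using less.prems True by simp
  qed
qed

definition weighted_deriv :: "complex poly \<Rightarrow> nat \<Rightarrow> complex poly" where
  "weighted_deriv \<phi> k = monom 1 k * (pderiv ^^ k) \<phi>"

text \<open>
  This recurrence makes the span of the generators invariant under \<^const>\<open>theta\<close>, and conversely
  expresses each generator through the previous one.
\<close>

lemma theta_weighted_deriv:
  "theta (weighted_deriv \<phi> k) = smult (of_nat k) (weighted_deriv \<phi> k) + weighted_deriv \<phi> (Suc k)"
proof -
  have leibniz: "theta (p * q) = theta p * q + p * theta q" for p q
    by (simp add: theta_def pderiv_mult algebra_simps)
  have monomial: "theta (monom 1 k) = smult (of_nat k) (monom 1 k)"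
    by (simp add: poly_eq_iff coeff_theta)
  have "monom 1 k * theta q = monom 1 (Suc k) * pderiv q" for q :: "complex poly"
    by (simp add: theta_def monom_Suc)
  thus ?thesis
    by (simp add: weighted_deriv_def leibniz monomial)
qed

lemma weighted_deriv_1: "weighted_deriv \<phi> 1 = theta \<phi>"
  by (simp add: weighted_deriv_def theta_def monom_Suc monom_0)

lemma subspace_polys_on: "poly_vs.subspace (polys_on S)"
  by (auto simp: poly_vs.subspace_def polys_on_def) (metis add.right_neutral)

lemma theta_polys_on: "p \<in> polys_on (insert 0 S) \<Longrightarrow> theta p \<in> polys_on S"
  by (auto simp: polys_on_def coeff_theta)

text \<open>
  The span on the left is invariant under \<^const>\<open>theta\<close> and contains \<open>\<theta> \<phi>\<close>, whose exponents are the
  nonzero exponents of \<open>\<phi>\<close>; hence it contains the corresponding monomials. The exponent \<open>1\<close> is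
  always present because of the generator \<open>x\<close>, which is why the linear coefficient of \<open>\<phi>\<close> is invisible.
\<close>

lemma span_weighted_derivs:
  "poly_vs.span (insert [:0, 1:] {weighted_deriv \<phi> k | k. k \<ge> 1}) = polys_on (insert 1 (index_set \<phi>))"
    (is "poly_vs.span ?B = polys_on ?S")
proof
  have wd: "weighted_deriv \<phi> k \<in> polys_on ?S" if "k \<ge> 1" for k
    using that
  proof (induction k rule: dec_induct)
    case base
    have "coeff \<phi> i \<noteq> 0 \<Longrightarrow> i \<noteq> 0 \<Longrightarrow> i \<in> ?S" for i by (auto simp: index_set_def)
    thus ?case unfolding weighted_deriv_1 by (auto simp: polys_on_def coeff_theta)
  next
    case (step k)
    have "weighted_deriv \<phi> (Suc k) = theta (weighted_deriv \<phi> k) - smult (of_nat k) (weighted_deriv \<phi> k)"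
      by (simp add: theta_weighted_deriv)
    thus ?case using step subspace_polys_on
      by (auto intro!: poly_vs.subspace_diff poly_vs.subspace_scale simp: polys_on_def coeff_theta)
  qed
  have "[:0, 1:] \<in> polys_on ?S"
    by (auto simp: polys_on_def coeff_pCons split: nat.splits)
  thus "poly_vs.span ?B \<subseteq> polys_on ?S"
    using wd by (intro poly_vs.span_minimal subspace_polys_on) auto
next
  have theta: "theta p \<in> poly_vs.span ?B" if "p \<in> poly_vs.span ?B" for p
    using that
  proof (induction rule: poly_vs.span_induct_alt)
    case base
    show ?case by (simp add: theta_def poly_vs.span_zero)
  next
    case (step c b p)
    have "theta b \<in> poly_vs.span ?B"
    proof (cases "b = [:0, 1:]")
      case True
      hence "theta b = [:0, 1:]" by (simp add: theta_def pderiv_pCons)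
      thus ?thesis by (auto intro: poly_vs.span_base)
    next
      case False
      with step obtain k where "k \<ge> 1" "b = weighted_deriv \<phi> k" by auto
      thus ?thesis unfolding \<open>b = _\<close> theta_weighted_deriv
        by (intro poly_vs.span_add poly_vs.span_scale poly_vs.span_base) (auto intro: le_SucI)
    qed
    moreover have "theta (smult c b + p) = smult c (theta b) + theta p"
      by (simp add: theta_def pderiv_add pderiv_smult)
    ultimately show ?case using step by (simp add: poly_vs.span_add poly_vs.span_scale)
  qed
  have mon: "monom 1 i \<in> poly_vs.span ?B" if "i \<in> ?S" for i
  proof (cases "i = 1")
    case True
    have "monom 1 i = [:0, 1:]" using True by (simp add: monom_Suc monom_0)
    thus ?thesis by (auto intro: poly_vs.span_base)
  next
    case False
    have "theta \<phi> \<in> poly_vs.span ?B"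
      by (rule poly_vs.span_base) (auto simp flip: weighted_deriv_1)
    moreover have "coeff (theta \<phi>) i \<noteq> 0"
      using False that by (auto simp: coeff_theta index_set_def)
    ultimately show ?thesis
      using monomials_in_theta_invariant_subspace [OF poly_vs.subspace_span theta] by blast
  qed
  show "polys_on ?S \<subseteq> poly_vs.span ?B"
  proof
    fix p assume p: "p \<in> polys_on ?S"
    have "smult (coeff p i) (monom 1 i) \<in> poly_vs.span ?B" for i
      using p mon [of i] by (cases "coeff p i = 0")
        (auto simp: polys_on_def intro: poly_vs.span_zero poly_vs.span_scale)
    thus "p \<in> poly_vs.span ?B"
      by (subst sum_of_monomials) (auto intro!: poly_vs.span_sum)
  qed
qed

section \<open>Normal forms of the two Lie algebras\<close>

lemma D_op_eq: "D_op a = lie_elem a 1 0 (- [:0, 1:])"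
proof -
  have "D_op a = euler_op 1 (\<lambda>x. mat (of_real x) ** (A_mat a - mat 1))"
    by (simp add: D_op_def euler_op_def)
  also have "\<dots> = lie_elem a 1 0 (- [:0, 1:])"
    unfolding lie_elem_def by (rule arg_cong [where f = "euler_op _"])
      (simp add: AJ_fun_def fun_eq_iff vec_eq_iff mat_mult_nth mat_nth algebra_simps)
  finally show ?thesis .
qed

lemma D_dag_op_eq:
  "(D_dag_op \<nu> \<phi> :: 'n::{finite,linorder} mop) = lie_elem a (- 1) 1 (theta \<phi> - [:1 + of_real \<nu>, 1:])"
proof -
  have "(\<lambda>x. - mat (of_real x) :: 'n cmat) = (\<lambda>x. mat (- 1 * of_real x))"
    by (simp add: fun_eq_iff vec_eq_iff mat_nth)
  hence "D_dag_op \<nu> \<phi> = euler_op (- 1) (\<lambda>x. - (mat (1 + of_real \<nu>) + J_mat :: 'n cmat)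
            + mat (of_real x * poly (pderiv \<phi>) (of_real x)) - mat (of_real x))"
    by (simp only: D_dag_op_def euler_op_def)
  also have "\<dots> = lie_elem a (- 1) 1 (theta \<phi> - [:1 + of_real \<nu>, 1:])"
    unfolding lie_elem_def by (rule arg_cong [where f = "euler_op _"])
      (simp add: AJ_fun_def fun_eq_iff vec_eq_iff mat_mult_nth mat_nth theta_def algebra_simps)
  finally show ?thesis .
qed

lemma mult_op_poly: "mult_op (\<lambda>x. poly p (of_real x)) = lie_elem a 0 0 p"
  unfolding lie_elem_def mult_op_eq_euler_op by (rule arg_cong [where f = "euler_op _"])
    (simp add: AJ_fun_def fun_eq_iff)

lemma pow_deriv_op_eq: "pow_deriv_op \<phi> k = lie_elem a 0 0 (weighted_deriv \<phi> k)"
  unfolding pow_deriv_op_def mult_op_poly [symmetric]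
  by (simp add: weighted_deriv_def poly_monom)

lemma mult_op_1_eq: "mult_op (\<lambda>_. 1) = lie_elem a 0 0 1"
  using mult_op_poly [of 1] by simp

lemma mult_op_of_real_eq: "mult_op of_real = lie_elem a 0 0 [:0, 1:]"
  using mult_op_poly [of "[:0, 1:]"] by simp

lemma lie_elem_zero: "lie_elem a 0 0 0 = 0"
  using lie_elem_scale [of 0 a 0 0 0] by simp

lemma subspace_lie_elems:
  assumes "mop.subspace L"
  shows "poly_vs.subspace {p. lie_elem a 0 0 p \<in> L}"
  unfolding poly_vs.subspace_def
proof (intro conjI ballI allI)
  show "0 \<in> {p. lie_elem a 0 0 p \<in> L}"
    using mop.subspace_0 [OF assms] by (simp add: lie_elem_zero)
next
  fix p q assume "p \<in> {p. lie_elem a 0 0 p \<in> L}" "q \<in> {p. lie_elem a 0 0 p \<in> L}"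
  thus "p + q \<in> {p. lie_elem a 0 0 p \<in> L}"
    using mop.subspace_add [OF assms, of "lie_elem a 0 0 p" "lie_elem a 0 0 q"] by (simp add: lie_elem_add)
next
  fix c p assume "p \<in> {p. lie_elem a 0 0 p \<in> L}"
  thus "smult c p \<in> {p. lie_elem a 0 0 p \<in> L}"
    using mop.subspace_scale [OF assms, of "lie_elem a 0 0 p" c] by (simp add: lie_elem_scale)
qed

text \<open>
  The two cases for \<open>B\<close> are those of \<open>\<hh>\<close> and of \<open>\<gg>\<close>: without and with the central element \<open>x A - J\<close>.
\<close>

lemma subspace_lie_elem_family:
  assumes W: "poly_vs.subspace W" and B: "B = {0} \<or> B = UNIV"
  shows "mop.subspace {lie_elem a \<alpha> \<beta> p | \<alpha> \<beta> p. \<beta> \<in> B \<and> p \<in> W}" (is "mop.subspace ?L")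
  unfolding mop.subspace_def
proof (intro conjI ballI allI)
  show "0 \<in> ?L"
    using W B lie_elem_zero [of a] poly_vs.subspace_0 by (metis (mono_tags, lifting) CollectI UNIV_I singletonI)
next
  fix X Y assume "X \<in> ?L" "Y \<in> ?L"
  then obtain \<alpha> \<beta> p \<alpha>' \<beta>' q where "X = lie_elem a \<alpha> \<beta> p" "Y = lie_elem a \<alpha>' \<beta>' q"
    "\<beta> \<in> B" "\<beta>' \<in> B" "p \<in> W" "q \<in> W" by blast
  moreover have "\<beta> + \<beta>' \<in> B" using B calculation by auto
  ultimately show "X + Y \<in> ?L" using poly_vs.subspace_add [OF W] lie_elem_add by blast
next
  fix c X assume "X \<in> ?L"
  then obtain \<alpha> \<beta> p where "X = lie_elem a \<alpha> \<beta> p" "\<beta> \<in> B" "p \<in> W" by blast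
  moreover have "c * \<beta> \<in> B" using B calculation by auto
  ultimately show "op_scale c X \<in> ?L" using poly_vs.subspace_scale [OF W] lie_elem_scale by blast
qed

text \<open>
  The right-hand side involves \<open>\<phi>\<close> only through its index set, since \<open>x\<close> lies in the algebra and can be used to
  replace \<open>\<D>\<close> by \<open>\<D> + x\<close>.
\<close>

lemma h_alg_eq:
  "h_alg a \<phi> = {lie_elem a \<alpha> 0 p | \<alpha> p. p \<in> polys_on (insert 1 (index_set \<phi>))}" (is "_ = ?R")
proof
  have mem: "lie_elem a \<alpha> 0 p \<in> ?R" if "p \<in> polys_on (insert 1 (index_set \<phi>))" for \<alpha> p
    using that by blast
  have R: "?R = {lie_elem a \<alpha> \<beta> p | \<alpha> \<beta> p. \<beta> \<in> {0} \<and> p \<in> polys_on (insert 1 (index_set \<phi>))}"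
    by simp
  have gen: "[:0, 1:] \<in> polys_on (insert 1 (index_set \<phi>))"
    "k \<ge> 1 \<Longrightarrow> weighted_deriv \<phi> k \<in> polys_on (insert 1 (index_set \<phi>))" for k
    unfolding span_weighted_derivs [symmetric] by (auto intro: poly_vs.span_base)
  have "mop.subspace ?R"
    unfolding R by (intro subspace_lie_elem_family subspace_polys_on) simp
  moreover have "{D_op a, mult_op of_real} \<union> {pow_deriv_op \<phi> k | k. k \<ge> 1} \<subseteq> ?R"
  proof (intro Un_least insert_subsetI empty_subsetI)
    show "D_op a \<in> ?R"
      unfolding D_op_eq by (rule mem [OF poly_vs.subspace_neg [OF subspace_polys_on gen(1)]])
    show "mult_op of_real \<in> ?R"
      unfolding mult_op_of_real_eq [of a] by (rule mem [OF gen(1)])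
    show "{pow_deriv_op \<phi> k | k. k \<ge> 1} \<subseteq> ?R"
      unfolding pow_deriv_op_eq [of _ _ a] by (intro subsetI) (elim CollectE exE conjE, simp only: mem gen)
  qed
  ultimately show "h_alg a \<phi> \<subseteq> ?R"
    unfolding h_alg_def by (rule mop.span_minimal [rotated])
next
  let ?h = "h_alg a \<phi>"
  have sub: "mop.subspace ?h" by (simp add: h_alg_def)
  have D: "lie_elem a 1 0 (- [:0, 1:]) \<in> ?h"
    unfolding D_op_eq [symmetric] h_alg_def by (rule mop.span_base) simp
  have "insert [:0, 1:] {weighted_deriv \<phi> k | k. k \<ge> 1} \<subseteq> {p. lie_elem a 0 0 p \<in> ?h}"
    unfolding h_alg_def by (auto simp flip: mult_op_of_real_eq pow_deriv_op_eq intro!: mop.span_base)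
  hence "polys_on (insert 1 (index_set \<phi>)) \<subseteq> {p. lie_elem a 0 0 p \<in> ?h}"
    unfolding span_weighted_derivs [symmetric]
    by (rule poly_vs.span_minimal) (rule subspace_lie_elems [OF sub])
  moreover have x: "[:0, 1:] \<in> polys_on (insert 1 (index_set \<phi>))"
    unfolding span_weighted_derivs [symmetric] by (rule poly_vs.span_base) simp
  have "p + smult \<alpha> [:0, 1:] \<in> polys_on (insert 1 (index_set \<phi>))"
    if "p \<in> polys_on (insert 1 (index_set \<phi>))" for \<alpha> p
    using that x by (intro poly_vs.subspace_add poly_vs.subspace_scale subspace_polys_on)
  ultimately have V: "lie_elem a 0 0 (p + smult \<alpha> [:0, 1:]) \<in> ?h"
    if "p \<in> polys_on (insert 1 (index_set \<phi>))" for \<alpha> p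
    using that by blast
  show "?R \<subseteq> ?h"
  proof
    fix X assume "X \<in> ?R"
    then obtain \<alpha> p where X: "X = lie_elem a \<alpha> 0 p" and p: "p \<in> polys_on (insert 1 (index_set \<phi>))" by blast
    have cancel: "\<alpha> * 1 + 0 = \<alpha>" "\<alpha> * 0 + 0 = 0" "smult \<alpha> (- q) + (p + smult \<alpha> q) = p" for q
      unfolding smult_minus_right by simp_all
    have "X = op_scale \<alpha> (lie_elem a 1 0 (- [:0, 1:])) + lie_elem a 0 0 (p + smult \<alpha> [:0, 1:])"
      unfolding X lie_elem_add lie_elem_scale cancel ..
    thus "X \<in> ?h"
      using mop.subspace_add [OF sub mop.subspace_scale [OF sub D] V [OF p]] by (simp only:)
  qed
qed

lemma lie_elem_in_h_alg: "p \<in> polys_on (insert 1 (index_set \<phi>)) \<Longrightarrow> lie_elem a \<alpha> 0 p \<in> h_alg a \<phi>"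
  unfolding h_alg_eq by blast

lemma h_alg_subset_g_alg: "h_alg a \<phi> \<subseteq> g_alg \<nu> a \<phi>"
  unfolding h_alg_def g_alg_def by (rule mop.span_mono) auto

lemma D_dag_poly_in_polys_on:
  "theta \<phi> - [:1 + of_real \<nu>, 1:] \<in> polys_on ({0, 1} \<union> index_set \<phi>)"
  by (auto simp: polys_on_def coeff_theta index_set_def coeff_pCons split: nat.splits if_splits)

text \<open>
  The operator \<open>\<D> + \<D>\<^sup>\<dagger>\<close> equals \<open>x A - J\<close> up to a scalar polynomial in the algebra, so that
  \<open>\<nu>\<close> and \<open>\<phi>\<close> disappear from \<open>\<D>\<^sup>\<dagger>\<close> after a change of generators. The exponent \<open>0\<close> comes
  from the generator \<open>1\<close>.
\<close>

lemma g_alg_eq: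
  "g_alg \<nu> a \<phi> = {lie_elem a \<alpha> \<beta> p | \<alpha> \<beta> p. p \<in> polys_on ({0, 1} \<union> index_set \<phi>)}" (is "_ = ?R")
proof
  let ?S = "{0, 1} \<union> index_set \<phi>"
  have R: "?R = {lie_elem a \<alpha> \<beta> p | \<alpha> \<beta> p. \<beta> \<in> UNIV \<and> p \<in> polys_on ?S}"
    by simp
  have mem: "lie_elem a \<alpha> \<beta> p \<in> ?R" if "p \<in> polys_on ?S" for \<alpha> \<beta> p
    using that by blast
  have "polys_on (insert 1 (index_set \<phi>)) \<subseteq> polys_on ?S"
    by (auto simp: polys_on_def)
  hence "poly_vs.span (insert [:0, 1:] {weighted_deriv \<phi> k | k. k \<ge> 1}) \<subseteq> polys_on ?S"
    by (simp only: span_weighted_derivs)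
  hence gen: "[:0, 1:] \<in> polys_on ?S"
    "k \<ge> 1 \<Longrightarrow> weighted_deriv \<phi> k \<in> polys_on ?S" for k
    by (blast intro: poly_vs.span_base)+
  have one: "1 \<in> polys_on ?S" by (auto simp: polys_on_def)
  note dag = D_dag_poly_in_polys_on
  have "mop.subspace ?R"
    unfolding R by (intro subspace_lie_elem_family subspace_polys_on) simp
  moreover have "{mult_op (\<lambda>_. 1), D_op a, D_dag_op \<nu> \<phi>, mult_op of_real} \<union> {pow_deriv_op \<phi> k | k. k \<ge> 1} \<subseteq> ?R"
  proof (intro Un_least insert_subsetI empty_subsetI)
    show "mult_op (\<lambda>_. 1) \<in> ?R"
      unfolding mult_op_1_eq [of a] by (rule mem [OF one])
    show "D_op a \<in> ?R"
      unfolding D_op_eq by (rule mem [OF poly_vs.subspace_neg [OF subspace_polys_on gen(1)]])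
    show "D_dag_op \<nu> \<phi> \<in> ?R"
      unfolding D_dag_op_eq [of _ _ a] by (rule mem [OF dag])
    show "mult_op of_real \<in> ?R"
      unfolding mult_op_of_real_eq [of a] by (rule mem [OF gen(1)])
    show "{pow_deriv_op \<phi> k | k. k \<ge> 1} \<subseteq> ?R"
      unfolding pow_deriv_op_eq [of _ _ a] by (intro subsetI) (elim CollectE exE conjE, simp only: mem gen)
  qed
  ultimately show "g_alg \<nu> a \<phi> \<subseteq> ?R"
    unfolding g_alg_def by (rule mop.span_minimal [rotated])
next
  let ?g = "g_alg \<nu> a \<phi>" and ?S = "{0, 1} \<union> index_set \<phi>"
  have sub: "mop.subspace ?g" by (simp add: g_alg_def)
  have one: "lie_elem a 0 0 1 \<in> ?g"
    unfolding mult_op_1_eq [symmetric] g_alg_def by (rule mop.span_base) simp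
  have dag: "lie_elem a (- 1) 1 (theta \<phi> - [:1 + of_real \<nu>, 1:]) \<in> ?g"
    unfolding D_dag_op_eq [symmetric] g_alg_def by (rule mop.span_base) simp
  have h: "lie_elem a \<alpha> 0 p \<in> ?g" if "p \<in> polys_on (insert 1 (index_set \<phi>))" for \<alpha> p
    using lie_elem_in_h_alg [OF that] h_alg_subset_g_alg by blast
  have h': "lie_elem a \<alpha> 0 p \<in> ?g" if p: "p \<in> polys_on ?S" for \<alpha> p
  proof -
    have "p - smult (coeff p 0) 1 \<in> polys_on (insert 1 (index_set \<phi>))"
      using p by (auto simp: polys_on_def coeff_pCons split: if_splits nat.splits)
    hence "lie_elem a \<alpha> 0 (p - smult (coeff p 0) 1) + op_scale (coeff p 0) (lie_elem a 0 0 1) \<in> ?g"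
      by (intro mop.subspace_add mop.subspace_scale sub one h)
    thus ?thesis by (simp add: lie_elem_add lie_elem_scale)
  qed
  show "?R \<subseteq> ?g"
  proof
    fix X assume "X \<in> ?R"
    then obtain \<alpha> \<beta> p where X: "X = lie_elem a \<alpha> \<beta> p" and p: "p \<in> polys_on ?S" by blast
    \<comment> \<open>Subtracting \<open>\<beta> \<D>\<^sup>\<dagger>\<close> removes the central part and leaves an element without \<open>x A - J\<close>.\<close>
    let ?r = "theta \<phi> - [:1 + of_real \<nu>, 1:]"
    have "X = op_scale \<beta> (lie_elem a (- 1) 1 ?r) + lie_elem a (\<alpha> + \<beta>) 0 (p - smult \<beta> ?r)"
      by (simp add: X lie_elem_add lie_elem_scale)
    moreover have "p - smult \<beta> ?r \<in> polys_on ?S"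
      by (intro poly_vs.subspace_diff poly_vs.subspace_scale subspace_polys_on p D_dag_poly_in_polys_on)
    ultimately show "X \<in> ?g"
      using mop.subspace_add [OF sub mop.subspace_scale [OF sub dag] h'] by (simp only:)
  qed
qed

section \<open>Isomorphisms\<close>

lemma lie_isomorphic_refl: "lie_isomorphic L L"
  unfolding lie_isomorphic_def by (rule exI [of _ id]) auto

lemma lie_isomorphic_sym:
  assumes "lie_isomorphic L M" and sub: "mop.subspace L"
    and bracket: "\<And>X Y. X \<in> L \<Longrightarrow> Y \<in> L \<Longrightarrow> op_bracket X Y \<in> L"
  shows "lie_isomorphic M L"
proof -
  obtain f where bij: "bij_betw f L M"
    and add: "\<And>X Y. X \<in> L \<Longrightarrow> Y \<in> L \<Longrightarrow> f (X + Y) = f X + f Y"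
    and scale: "\<And>c X. X \<in> L \<Longrightarrow> f (op_scale c X) = op_scale c (f X)"
    and br: "\<And>X Y. X \<in> L \<Longrightarrow> Y \<in> L \<Longrightarrow> f (op_bracket X Y) = op_bracket (f X) (f Y)"
    using assms(1) unfolding lie_isomorphic_def by blast
  define g where "g = inv_into L f"
  have g: "g Y \<in> L" "f (g Y) = Y" if "Y \<in> M" for Y
    using that bij by (auto simp: g_def bij_betw_def inv_into_into f_inv_into_f)
  have gf: "g (f X) = X" if "X \<in> L" for X
    using that bij by (simp add: g_def bij_betw_def)
  show ?thesis
    unfolding lie_isomorphic_def
  proof (intro exI [of _ g] conjI ballI allI)
    show "bij_betw g M L" unfolding g_def by (rule bij_betw_inv_into [OF bij])
    show "g (X + Y) = g X + g Y" if "X \<in> M" "Y \<in> M" for X Y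
      using gf [OF mop.subspace_add [OF sub g(1) g(1)]] add g that by metis
    show "g (op_scale c X) = op_scale c (g X)" if "X \<in> M" for c X
      using gf [OF mop.subspace_scale [OF sub g(1)]] scale g that by metis
    show "g (op_bracket X Y) = op_bracket (g X) (g Y)" if "X \<in> M" "Y \<in> M" for X Y
      using gf [OF bracket [OF g(1) g(1)]] br g that by metis
  qed
qed

text \<open>
  An isomorphism turns \<open>[\<D> + x, x\<^sup>i] = - i x\<^sup>i\<close> into an eigenvector equation for the image of \<open>\<D> + x\<close>. As
  \<open>i \<noteq> 0\<close>, the image of \<open>x\<^sup>i\<close> is a multiple of a bracket, hence a scalar polynomial, and on those the image
  of \<open>\<D> + x\<close> acts as \<open>- \<alpha> \<theta>\<close>. So \<open>i = \<alpha> n\<close> for some exponent \<open>n\<close> in \<open>T\<close>, with the same \<open>\<alpha>\<close>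
  for all \<open>i\<close>; the case \<open>i = 1\<close> shows that \<open>1 / \<alpha>\<close> is an exponent \<open>j\<close>. It suffices
  that \<open>L\<close> contains the elements used and that \<open>M\<close> is contained in a large enough family, which
  treats \<open>\<hh>\<close> and \<open>\<gg>\<close> simultaneously.
\<close>

lemma isomorphism_rescales_exponents:
  fixes L M :: "'n::{finite,linorder} mop set"
  assumes iso: "lie_isomorphic L M" and sub: "mop.subspace L"
    and D: "lie_elem a 1 0 0 \<in> L" and mon: "\<And>i. i \<in> S \<Longrightarrow> lie_elem a 0 0 (monom 1 i) \<in> L"
    and M: "M \<subseteq> {lie_elem a \<alpha> \<beta> p | \<alpha> \<beta> p. p \<in> polys_on (insert 0 T)}"
    and S: "1 \<in> S" "0 \<notin> S"
  shows "\<exists>j\<in>T. \<forall>i\<in>S. i * j \<in> T"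
proof -
  obtain f where bij: "bij_betw f L M"
    and scale: "\<And>c X. X \<in> L \<Longrightarrow> f (op_scale c X) = op_scale c (f X)"
    and br: "\<And>X Y. X \<in> L \<Longrightarrow> Y \<in> L \<Longrightarrow> f (op_bracket X Y) = op_bracket (f X) (f Y)"
    using iso unfolding lie_isomorphic_def by blast
  have fM: "f X \<in> M" if "X \<in> L" for X
    using that bij by (auto simp: bij_betw_def)
  obtain \<alpha> \<beta> r where fD: "f (lie_elem a 1 0 0) = lie_elem a \<alpha> \<beta> r"
    and r: "r \<in> polys_on (insert 0 T)"
    using fM [OF D] M by blast
  have eigenvalue: "\<exists>n\<in>T. \<alpha> * of_nat n = of_nat i" if i: "i \<in> S" for i
  proof -
    let ?X = "lie_elem a 0 0 (monom 1 i) :: 'n mop"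
    have i0: "of_nat i \<noteq> (0 :: complex)" using S(2) i by (metis of_nat_eq_0_iff)
    have DX: "op_bracket (lie_elem a 1 0 0) ?X = op_scale (- of_nat i) ?X"
      unfolding lie_elem_bracket lie_elem_scale
      by (rule arg_cong [where f = "lie_elem a 0 0", THEN trans]) (simp_all add: poly_eq_iff coeff_theta)
    have eig: "op_bracket (lie_elem a \<alpha> \<beta> r) (f ?X) = op_scale (- of_nat i) (f ?X)"
      using br [OF D mon [OF i]] scale [OF mon [OF i]] by (simp only: DX fD)
    obtain \<alpha>' \<beta>' q where fX: "f ?X = lie_elem a \<alpha>' \<beta>' q" "q \<in> polys_on (insert 0 T)"
      using fM [OF mon [OF i]] M by blast
    \<comment> \<open>\<open>w\<close> is the value of the bracket in \<open>eig\<close>, divided by the eigenvalue.\<close>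
    define w where "w = smult (inverse (- of_nat i)) (smult \<alpha>' (theta r) - smult \<alpha> (theta q))"
    have "f ?X = op_scale (inverse (- of_nat i)) (op_scale (- of_nat i) (f ?X))"
      using i0 by (simp only: mop.scale_scale) simp
    also have "\<dots> = lie_elem a 0 0 w"
      unfolding eig [symmetric] unfolding fX(1) lie_elem_bracket lie_elem_scale by (simp add: w_def)
    finally have w: "f ?X = lie_elem a 0 0 w" .
    have "w \<in> polys_on T"
      unfolding w_def using r fX(2)
      by (intro poly_vs.subspace_scale poly_vs.subspace_diff subspace_polys_on theta_polys_on)
    moreover have "w \<noteq> 0"
    proof
      assume "w = 0"
      hence "f ?X = f 0"
        using scale [OF mop.subspace_0 [OF sub], of 0] by (simp add: w lie_elem_zero)
      hence "?X = lie_elem a 0 0 0"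
        unfolding lie_elem_zero
        by (rule inj_onD [OF bij_betw_imp_inj_on [OF bij] _ mon [OF i] mop.subspace_0 [OF sub]])
      thus False by (simp only: lie_elem_scalar_inject monom_eq_0_iff) simp
    qed
    ultimately obtain n where n: "coeff w n \<noteq> 0" "n \<in> T"
      by (auto simp: polys_on_def poly_eq_iff)
    have "smult 0 (theta r) - smult \<alpha> (theta w) = smult (- of_nat i) w"
      using eig unfolding w lie_elem_bracket lie_elem_scale by (simp add: lie_elem_scalar_inject)
    hence "coeff (smult 0 (theta r) - smult \<alpha> (theta w)) n = coeff (smult (- of_nat i) w) n"
      by (rule arg_cong)
    with n show ?thesis by (intro bexI [of _ n]) (auto simp: coeff_theta)
  qed
  from eigenvalue [OF S(1)] obtain j where j: "j \<in> T" "\<alpha> * of_nat j = 1"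
    by auto
  have "i * j \<in> T" if i: "i \<in> S" for i
  proof -
    obtain n where n: "n \<in> T" "\<alpha> * of_nat n = of_nat i"
      using eigenvalue [OF i] by blast
    have "of_nat n = of_nat n * (\<alpha> * of_nat j)" by (simp add: j)
    also have "\<dots> = (of_nat (i * j) :: complex)" using n(2) by (simp add: ac_simps)
    finally have "n = i * j" by (simp only: of_nat_eq_iff)
    with n(1) show ?thesis by simp
  qed
  with j(1) show ?thesis by blast
qed

text \<open>
  Multiplication by \<open>j k\<close> maps the finite set \<open>S\<close> into itself and would move its maximum out of it
  unless \<open>j = k = 1\<close>.
\<close>

lemma eq_of_mutual_rescaling:
  fixes S T :: "nat set"
  assumes "finite S" "1 \<in> S"
    and "j \<in> T" "\<forall>i\<in>S. i * j \<in> T" and "k \<in> S" "\<forall>i\<in>T. i * k \<in> S"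
    and "0 \<notin> S" "0 \<notin> T"
  shows "S = T"
proof -
  have max: "Max S \<in> S" using assms by (auto intro: Max_in)
  hence "Max S * j * k \<in> S" using assms(4,6) by simp
  hence "Max S * (j * k) \<le> Max S * 1" using Max_ge [OF assms(1)] by (simp only: mult.assoc mult_1_right)
  moreover have "Max S > 0" "j > 0" "k > 0" using max assms(3,5,7,8) by (metis gr0I)+
  ultimately have "j * k \<le> 1" "j * k > 0" by simp_all
  hence "j * k = 1" by linarith
  hence "j = 1" "k = 1" by simp_all
  with assms show ?thesis by auto
qed

lemma index_set_eq_of_lie_isomorphic:
  fixes L M :: "'n::{finite,linorder} mop set"
  assumes iso: "lie_isomorphic L M"
    and L: "mop.subspace L" "h_alg a \<phi>1 \<subseteq> L" "L \<subseteq> g_alg \<nu> a \<phi>1"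
    and M: "mop.subspace M" "h_alg a \<phi>2 \<subseteq> M" "M \<subseteq> g_alg \<nu> a \<phi>2"
  shows "index_set \<phi>1 = index_set \<phi>2"
proof -
  let ?S = "\<lambda>\<phi>. insert 1 (index_set \<phi>)"
  have D: "lie_elem a 1 0 0 \<in> h_alg a \<phi>" for \<phi>
    by (intro lie_elem_in_h_alg poly_vs.subspace_0 subspace_polys_on)
  have mon: "lie_elem a 0 0 (monom 1 i) \<in> h_alg a \<phi>" if "i \<in> ?S \<phi>" for \<phi> i
  proof -
    have "monom 1 i \<in> polys_on (?S \<phi>)" using that by (auto simp: polys_on_def)
    thus ?thesis by (rule lie_elem_in_h_alg)
  qed
  have g: "g_alg \<nu> a \<phi> \<subseteq> {lie_elem a \<alpha> \<beta> p | \<alpha> \<beta> p. p \<in> polys_on (insert 0 (?S \<phi>))}" for \<phi>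
    unfolding g_alg_eq by simp
  have S: "1 \<in> ?S \<phi>" "0 \<notin> ?S \<phi>" for \<phi> by (auto simp: index_set_def)
  have bracket: "op_bracket X Y \<in> h_alg a \<phi>1" if XY: "X \<in> g_alg \<nu> a \<phi>1" "Y \<in> g_alg \<nu> a \<phi>1" for X Y
  proof -
    obtain \<alpha> \<beta> p where X: "X = lie_elem a \<alpha> \<beta> p" "p \<in> polys_on (insert 0 (?S \<phi>1))"
      using subsetD [OF g XY(1)] by (elim CollectE exE conjE) (rule that)
    obtain \<alpha>' \<beta>' q where Y: "Y = lie_elem a \<alpha>' \<beta>' q" "q \<in> polys_on (insert 0 (?S \<phi>1))"
      using subsetD [OF g XY(2)] by (elim CollectE exE conjE) (rule that)
    have "smult \<alpha>' (theta p) - smult \<alpha> (theta q) \<in> polys_on (?S \<phi>1)"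
      using X(2) Y(2)
      by (intro poly_vs.subspace_scale poly_vs.subspace_diff subspace_polys_on theta_polys_on)
    thus ?thesis unfolding X(1) Y(1) lie_elem_bracket by (rule lie_elem_in_h_alg)
  qed
  have "\<exists>j\<in>?S \<phi>2. \<forall>i\<in>?S \<phi>1. i * j \<in> ?S \<phi>2"
    using isomorphism_rescales_exponents [OF iso L(1) subsetD [OF L(2) D] subsetD [OF L(2) mon]
        order_trans [OF M(3) g] S] .
  moreover have "lie_isomorphic M L"
    by (rule lie_isomorphic_sym [OF iso L(1)]) (use bracket L in blast)
  from isomorphism_rescales_exponents [OF this M(1) subsetD [OF M(2) D] subsetD [OF M(2) mon]
        order_trans [OF L(3) g] S]
  have "\<exists>j\<in>?S \<phi>1. \<forall>i\<in>?S \<phi>2. i * j \<in> ?S \<phi>1" .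
  moreover have "finite (?S \<phi>1)"
    by (rule finite_subset [of _ "insert 1 {..degree \<phi>1}"]) (auto simp: index_set_def intro: le_degree)
  ultimately have "?S \<phi>1 = ?S \<phi>2"
    by (elim bexE) (rule eq_of_mutual_rescaling [OF _ S(1) _ _ _ _ S(2) S(2)])
  moreover have "1 \<notin> index_set \<phi>" for \<phi> by (auto simp: index_set_def)
  ultimately show ?thesis by (metis insert_ident)
qed

theorem theorem4p10:
  fixes \<nu> :: real and a :: "nat \<Rightarrow> real" and \<phi>1 \<phi>2 :: "complex poly"
  assumes "\<nu> > 0" and "degree \<phi>1 \<ge> 2" and "degree \<phi>2 \<ge> 2"
  shows "(lie_isomorphic (h_alg a \<phi>1 :: 'n::{finite,linorder} mop set) (h_alg a \<phi>2 :: 'n mop set)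
            \<longleftrightarrow> index_set \<phi>1 = index_set \<phi>2)
       \<and> (lie_isomorphic (g_alg \<nu> a \<phi>1 :: 'n mop set) (g_alg \<nu> a \<phi>2 :: 'n mop set)
            \<longleftrightarrow> index_set \<phi>1 = index_set \<phi>2)"
proof (intro conjI iffI)
  have sub: "mop.subspace (h_alg a \<phi> :: 'n mop set)" "mop.subspace (g_alg \<nu> a \<phi> :: 'n mop set)" for \<phi>
    by (simp_all add: h_alg_def g_alg_def)
  show "index_set \<phi>1 = index_set \<phi>2"
    if "lie_isomorphic (h_alg a \<phi>1 :: 'n mop set) (h_alg a \<phi>2 :: 'n mop set)"
    using index_set_eq_of_lie_isomorphic [OF that sub(1) order_refl h_alg_subset_g_alg
        sub(1) order_refl h_alg_subset_g_alg] .
  show "index_set \<phi>1 = index_set \<phi>2"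
    if "lie_isomorphic (g_alg \<nu> a \<phi>1 :: 'n mop set) (g_alg \<nu> a \<phi>2 :: 'n mop set)"
    using index_set_eq_of_lie_isomorphic [OF that sub(2) h_alg_subset_g_alg order_refl
        sub(2) h_alg_subset_g_alg order_refl] .
  assume "index_set \<phi>1 = index_set \<phi>2"
  hence "h_alg a \<phi>1 = (h_alg a \<phi>2 :: 'n mop set)" "g_alg \<nu> a \<phi>1 = (g_alg \<nu> a \<phi>2 :: 'n mop set)"
    by (simp_all add: h_alg_eq g_alg_eq)
  thus "lie_isomorphic (h_alg a \<phi>1 :: 'n mop set) (h_alg a \<phi>2 :: 'n mop set)"
    "lie_isomorphic (g_alg \<nu> a \<phi>1 :: 'n mop set) (g_alg \<nu> a \<phi>2 :: 'n mop set)"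
    by (simp_all add: lie_isomorphic_refl)
qed

end
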